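(* Let $G$ be a finite abelian group with $|G|\ge3$. 1. For every $k\in\mathbb N$, $\mathcal U_k(G)$ is an interval, $\rho(G)=\mathsf D(G)/2$, $\rho_{2k}(G)=k\,\mathsf D(G)$, and $$1+k\,\mathsf D(G)\le\rho_{2k+1}(G)\le k\,\mathsf D(G)+\Bigl\lfloor\frac{\mathsf D(G)}2\Bigr\rfloor .$$ 2. $\Delta(G)$ is an interval with $\min\Delta(G)=1$ and $\max\Delta(G)\le\mathsf D(G)-2$.
   Context: An interval is a set of the form $[a,b]=\{x\in\mathbb Z\mid a\le x\le b\}$ with $a,b\in\mathbb Z$. For an additive abelian group $G$, $\mathcal F(G)$ is the (multiplicatively written) free abelian monoid with basis $G$; for $S=g_1\cdots g_\ell\in\mathcal F(G)$, $|S|=\ell$ and $\sigma(S)=g_1+\dots+g_\ell$. $\mathcal B(G)=\{S\in\mathcal F(G)\mid\sigma(S)=0\}$ is the monoid of zero-sum sequences over $G$; its only invertible element is the empty sequence $1$. $\mathcal A(G)$ is the set of atoms of $\mathcal B(G)$ (elements $\neq1$ that are not products of two elements $\ne 1$ of $\mathcal B(G)$). $\mathsf D(G)=\max\{|U|\mid U\in\mathcal A(G)\}$ is the Davenport constant. For $A\in\mathcal B(G)\setminus\{1\}$, $\mathsf L(A)$ is the set of all $k\in\mathbb N$ such that $A$ is a product of $k$ atoms, and $\mathsf L(1)=\{0\}$; $\mathcal L(G)=\{\mathsf L(A)\mid A\in\mathcal B(G)\}$. For $L\subset\mathbb Z$, $\Delta(L)$ is the set of all $d\in\mathbb N$ such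 that there are $k,\ell\in L$ with $\ell-k=d$ and no element of $L$ strictly between $k$ and $\ell$; $\Delta(G)=\bigcup_{L\in\mathcal L(G)}\Delta(L)$. For nonempty $L\subset\mathbb N$, $\rho(L)=\sup L/\min L$, $\rho(\{0\})=1$; $\rho(G)=\sup\{\rho(L)\mid L\in\mathcal L(G)\}$. For $k\in\mathbb N$, $\mathcal U_k(G)$ is the set of all $\ell\in\mathbb N$ such that there are $U_1,\dots,U_k,V_1,\dots,V_\ell\in\mathcal A(G)$ with $U_1\cdots U_k=V_1\cdots V_\ell$, and $\rho_k(G)=\sup\mathcal U_k(G)$. *)

theory Defs
  imports "HOL-Library.Multiset" "HOL-Library.Cardinality" "HOL-Library.Extended_Real"
begin

text \<open>
  The abelian group \<open>G\<close> is the universe of a type \<open>'a\<close> of class \<open>ab_group_add\<close>. Sequences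
  over \<open>G\<close>, the elements of the free abelian monoid with basis \<open>G\<close>, are multisets: the
  product of sequences is multiset union \<open>+\<close>, the empty sequence \<open>1\<close> is \<open>{#}\<close>, the length
  is \<open>size\<close> and \<open>\<sigma>\<close> is \<open>sum_mset\<close>. A factorization is a multiset of atoms, whose
  product is again \<open>sum_mset\<close>, now taken in the monoid of multisets.
  Throughout, \<open>\<nat>\<close> denotes the positive integers.
\<close>

definition int_interval :: "int set \<Rightarrow> bool" where
  "int_interval X \<longleftrightarrow> (\<exists>a b. X = {a..b})"

definition zero_sum_seqs :: "'a::ab_group_add multiset set" where
  "zero_sum_seqs = {S. sum_mset S = 0}"

definition zero_sum_atoms :: "'a::ab_group_add multiset set" where
  "zero_sum_atoms =
     {U \<in> zero_sum_seqs. U \<noteq> {#} \<and>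
        \<not> (\<exists>S\<in>zero_sum_seqs. \<exists>T\<in>zero_sum_seqs. S \<noteq> {#} \<and> T \<noteq> {#} \<and> U = S + T)}"

text \<open>Meaningful when the set of lengths of atoms is finite, as it is for finite groups.\<close>

definition davenport :: "'a::ab_group_add itself \<Rightarrow> nat" where
  "davenport _ = Max (size ` (zero_sum_atoms :: 'a multiset set))"

definition lengths :: "'a::ab_group_add multiset \<Rightarrow> nat set" where
  "lengths A =
     (if A = {#} then {0}
      else {k. k \<ge> 1 \<and>
              (\<exists>F. size F = k \<and> set_mset F \<subseteq> zero_sum_atoms \<and> sum_mset F = A)})"

definition length_system :: "'a::ab_group_add itself \<Rightarrow> nat set set" where
  "length_system _ = lengths ` (zero_sum_seqs :: 'a multiset set)"

definition distances :: "int set \<Rightarrow> nat set" where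
  "distances L =
     {d. d \<ge> 1 \<and> (\<exists>k\<in>L. \<exists>l\<in>L. l - k = int d \<and> \<not> (\<exists>m\<in>L. k < m \<and> m < l))}"

definition group_distances :: "'a::ab_group_add itself \<Rightarrow> nat set" where
  "group_distances G = (\<Union>L\<in>length_system G. distances (int ` L))"

text \<open>
  Suprema are taken in the extended reals or naturals, so that unbounded sets have
  supremum \<open>\<infinity>\<close>. On nonempty sets of naturals, \<open>Inf\<close> is the minimum, also when the
  set is infinite.
\<close>

definition set_elasticity :: "nat set \<Rightarrow> ereal" where
  "set_elasticity L =
     (if L = {0} then 1 else (SUP l\<in>L. ereal (real l)) / ereal (real (Inf L)))"

definition elasticity :: "'a::ab_group_add itself \<Rightarrow> ereal" where
  "elasticity G = (SUP L\<in>length_system G. set_elasticity L)"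

definition unions_of_lengths :: "'a::ab_group_add itself \<Rightarrow> nat \<Rightarrow> nat set" where
  "unions_of_lengths _ k =
     {l. l \<ge> 1 \<and>
        (\<exists>U V :: 'a multiset multiset.
           set_mset U \<subseteq> zero_sum_atoms \<and> size U = k \<and>
           set_mset V \<subseteq> zero_sum_atoms \<and> size V = l \<and>
           sum_mset U = sum_mset V)}"

definition kth_elasticity :: "'a::ab_group_add itself \<Rightarrow> nat \<Rightarrow> enat" where
  "kth_elasticity G k = (SUP l\<in>unions_of_lengths G k. enat l)"

end

theory Submission
  imports Defs
begin

text \<open>
  Both interval statements rest on one operation: replace two terms \<open>g, h\<close> of a zero-sum
  sequence \<open>A\<close> by the single term \<open>g + h\<close>, obtaining a shorter sequence \<open>B\<close>. Every length
  of \<open>B\<close> or its successor is a length of \<open>A\<close>, every length \<open>l\<close> of \<open>A\<close> is matched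
  by a length at least \<open>l - 1\<close> of \<open>B\<close>, and \<open>k\<close> stays a length if \<open>g, h\<close> lie in one atom
  of a factorization of length \<open>k\<close>. Descending on \<open>|A|\<close> lowers the length paired with \<open>k\<close>,
  or a gap above \<open>k\<close>, in steps of at most one.

  For the bound on gaps, an atom \<open>U\<close> of a factorization of length \<open>k\<close> divides the product of at
  most \<open>|U|\<close> atoms of a factorization of length \<open>l\<close>. Exchanging these for \<open>U\<close> and a factorization
  of the cofactor shortens the latter factorization by at most \<open>D - 2\<close>. If \<open>l > k + D - 2\<close>, the
  result is still longer than \<open>k\<close>; cancel \<open>U\<close> and induct on \<open>k\<close>.
\<close>

section \<open>Atoms and sets of lengths\<close>

text \<open>In a zero-sum sequence the cofactor of a zero-sum divisor is again zero-sum, so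
  irreducibility can be tested on a single divisor \<open>S\<close> instead of a pair.\<close>

lemma zero_sum_atoms_iff:
  "U \<in> zero_sum_atoms \<longleftrightarrow>
     sum_mset U = 0 \<and> U \<noteq> {#} \<and> (\<forall>S. S \<subseteq># U \<and> sum_mset S = 0 \<longrightarrow> S = {#} \<or> S = U)"
proof -
  have "(\<exists>S T. sum_mset S = 0 \<and> sum_mset T = 0 \<and> S \<noteq> {#} \<and> T \<noteq> {#} \<and> U = S + T) \<longleftrightarrow>
        (\<exists>S. S \<subseteq># U \<and> sum_mset S = 0 \<and> S \<noteq> {#} \<and> S \<noteq> U)" if "sum_mset U = 0"
  proof
    assume "\<exists>S. S \<subseteq># U \<and> sum_mset S = 0 \<and> S \<noteq> {#} \<and> S \<noteq> U"
    then obtain S T where "U = S + T" "sum_mset S = 0" "S \<noteq> {#}" "S \<noteq> U"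
      by (auto simp: mset_subset_eq_exists_conv)
    with that show "\<exists>S T. sum_mset S = 0 \<and> sum_mset T = 0 \<and> S \<noteq> {#} \<and> T \<noteq> {#} \<and> U = S + T"
      by (intro exI[of _ S] exI[of _ T]) auto
  qed (metis add_cancel_right_right mset_subset_eq_add_left)
  then show ?thesis
    unfolding zero_sum_atoms_def zero_sum_seqs_def by blast
qed

lemma zero_sum_atomsD:
  assumes "U \<in> zero_sum_atoms"
  shows "sum_mset U = 0" "U \<noteq> {#}" "S \<subseteq># U \<Longrightarrow> sum_mset S = 0 \<Longrightarrow> S = {#} \<or> S = U"
  using assms by (simp_all add: zero_sum_atoms_iff)

lemma sum_mset_atoms_eq_empty:
  assumes "set_mset F \<subseteq> zero_sum_atoms" "sum_mset F = {#}"
  shows "F = {#}"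
  using assms zero_sum_atomsD(2) by (metis multi_nonempty_split subset_mset.add_eq_0_iff_both_eq_0 sum_mset.add_mset
      set_mset_add_mset_insert insert_subset)

text \<open>The empty multiset of atoms is the only factorization of \<open>{#}\<close>, and it has
  length 0; hence the case distinction in the definition disappears.\<close>

lemma lengths_iff:
  "k \<in> lengths A \<longleftrightarrow> (\<exists>F. set_mset F \<subseteq> zero_sum_atoms \<and> size F = k \<and> sum_mset F = A)"
proof (cases "A = {#}")
  case True
  then show ?thesis
    by (auto simp: lengths_def dest: sum_mset_atoms_eq_empty intro: exI[of _ "{#}"])
next
  case False
  then have "size F \<ge> 1" if "sum_mset F = A" for F
    using that by (cases F) auto
  with False show ?thesis by (auto simp: lengths_def)
qed

lemma lengthsE:
  assumes "k \<in> lengths A"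
  obtains F where "set_mset F \<subseteq> zero_sum_atoms" "size F = k" "sum_mset F = A"
  using assms by (auto simp: lengths_iff)

lemma lengthsI: "set_mset F \<subseteq> zero_sum_atoms \<Longrightarrow> size F \<in> lengths (sum_mset F)"
  by (auto simp: lengths_iff)

lemma lengths_add:
  assumes "k \<in> lengths A" "l \<in> lengths B"
  shows "k + l \<in> lengths (A + B)"
proof -
  obtain E F where "set_mset E \<subseteq> zero_sum_atoms" "size E = k" "sum_mset E = A"
    "set_mset F \<subseteq> zero_sum_atoms" "size F = l" "sum_mset F = B"
    using assms by (meson lengthsE)
  then show ?thesis using lengthsI[of "E + F"] by simp
qed

lemma lengths_zero_iff: "0 \<in> lengths A \<longleftrightarrow> A = {#}"
  by (auto simp: lengths_def)

lemma lengths_imp_zero_sum: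
  assumes "k \<in> lengths A"
  shows "sum_mset A = 0"
proof -
  have "sum_mset (sum_mset F) = 0" if "set_mset F \<subseteq> zero_sum_atoms"
    for F :: "'a multiset multiset"
    using that by (induction F) (auto dest: zero_sum_atomsD(1))
  with assms show ?thesis by (auto simp: lengths_iff)
qed

lemma one_in_lengths_iff: "1 \<in> lengths U \<longleftrightarrow> U \<in> zero_sum_atoms"
proof
  assume "1 \<in> lengths U"
  then obtain F where F: "set_mset F \<subseteq> zero_sum_atoms" "size F = Suc 0" "sum_mset F = U"
    by (auto elim: lengthsE)
  then obtain V where "F = {#V#}" by (metis One_nat_def size_1_singleton_mset)
  with F show "U \<in> zero_sum_atoms" by simp
next
  assume "U \<in> zero_sum_atoms"
  then show "1 \<in> lengths U" using lengthsI[of "{#U#}"] by simp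
qed

text \<open>A nonempty zero-sum sequence that is not an atom splits into two shorter ones, so
  factorizations exist by induction on the size.\<close>

lemma lengths_nonempty: "sum_mset A = 0 \<Longrightarrow> \<exists>k. k \<in> lengths A"
proof (induction "size A" arbitrary: A rule: less_induct)
  case less
  consider "A = {#}" | "A \<in> zero_sum_atoms"
    | S T where "A = S + T" "sum_mset S = 0" "S \<noteq> {#}" "T \<noteq> {#}"
    using less.prems unfolding zero_sum_atoms_iff mset_subset_eq_exists_conv by fastforce
  then show ?case
  proof cases
    case 3
    then have "size S < size A" "size T < size A" "sum_mset T = 0"
      using less.prems by (auto simp: nonempty_has_size)
    then show ?thesis using less.hyps lengths_add 3 by metis
  qed (use lengths_zero_iff one_in_lengths_iff in blast)+
qed

text \<open>Any atom \<open>V\<close> of a factorization of \<open>U\<close> is a nonempty zero-sum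
  divisor of \<open>U\<close>, hence equal to \<open>U\<close>; nothing is left for further
  factors.\<close>

lemma lengths_atom:
  assumes U: "U \<in> zero_sum_atoms"
  shows "lengths U = {1}"
proof -
  have "k = 1" if "k \<in> lengths U" for k
  proof -
    from that obtain F where F: "set_mset F \<subseteq> zero_sum_atoms" "size F = k" "sum_mset F = U"
      by (rule lengthsE)
    have "F \<noteq> {#}" using F zero_sum_atomsD(2)[OF U] by auto
    then obtain V E where E: "F = add_mset V E" by (meson multiset_cases)
    then have V: "V \<in> zero_sum_atoms" using F by simp
    have "V \<subseteq># U" using F E by auto
    then have "V = U" using zero_sum_atomsD(3)[OF U] zero_sum_atomsD(1,2)[OF V] by blast
    then have "sum_mset E = {#}" using F E by simp
    then have "E = {#}" using sum_mset_atoms_eq_empty F E by auto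
    then show "k = 1" using F E by simp
  qed
  with U show ?thesis using one_in_lengths_iff by blast
qed

section \<open>Merging two terms of a sequence\<close>

text \<open>Of a zero-sum divisor of the merged sequence and its cofactor, one avoids the new term
  \<open>g + h\<close> and so divides \<open>R\<close>. It is then a proper zero-sum divisor of the
  original atom, hence empty.\<close>

lemma atom_merge:
  assumes U: "add_mset g (add_mset h R) \<in> zero_sum_atoms"
  shows "add_mset (g + h) R \<in> zero_sum_atoms"
proof -
  have sub: "P = {#}" if "P \<subseteq># R" "sum_mset P = 0" for P
  proof -
    have "P \<subseteq># add_mset g (add_mset h R)"
      using that(1) by (auto simp: mset_subset_eq_exists_conv)
    moreover have "P \<noteq> add_mset g (add_mset h R)"
      using size_mset_mono[OF that(1)] by auto
    ultimately show ?thesis using zero_sum_atomsD(3)[OF U] that(2) by blast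
  qed
  have sum0: "g + h + sum_mset R = 0"
    using zero_sum_atomsD(1)[OF U] by (simp add: add.assoc)
  have "T = {#} \<or> T = add_mset (g + h) R"
    if T: "T \<subseteq># add_mset (g + h) R" "sum_mset T = 0" for T
  proof -
    obtain C where C: "add_mset (g + h) R = T + C"
      using T(1) by (auto simp: mset_subset_eq_exists_conv)
    have sC: "sum_mset C = 0"
      using arg_cong[OF C, of sum_mset] sum0 T(2) by (simp add: add.assoc)
    show ?thesis
    proof (cases "g + h \<in># T")
      case True
      then obtain T1 where "T = add_mset (g + h) T1" by (meson mset_add)
      then have "C \<subseteq># R" using C by simp
      then show ?thesis using sub sC C by simp
    next
      case False
      then have "g + h \<in># C" using C by (metis union_iff union_single_eq_member)
      then obtain C1 where "C = add_mset (g + h) C1" by (meson mset_add)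
      then have "T \<subseteq># R" using C by simp
      then show ?thesis using sub T(2) by blast
    qed
  qed
  then show ?thesis using sum0 by (simp add: zero_sum_atoms_iff add.assoc)
qed

text \<open>Both terms lie in one atom, which remains an atom by \<open>atom_merge\<close>, so the
  number of factors does not change.\<close>

lemma lengths_merge_same:
  assumes F: "set_mset F \<subseteq> zero_sum_atoms" and U: "add_mset g (add_mset h R) \<in># F"
    and A: "sum_mset F = add_mset g (add_mset h Q)"
  shows "size F \<in> lengths (add_mset (g + h) Q)"
proof -
  obtain E where E: "F = add_mset (add_mset g (add_mset h R)) E" using U by (meson mset_add)
  have "size (add_mset (add_mset (g + h) R) E) \<in> lengths (sum_mset (add_mset (add_mset (g + h) R) E))"
    using F E by (intro lengthsI) (auto intro: atom_merge)
  moreover have "Q = R + sum_mset E" using A E by simp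
  ultimately show ?thesis using E by simp
qed

lemma lengths_merge:
  assumes "l \<in> lengths (add_mset g (add_mset h Q))"
  shows "\<exists>m \<in> lengths (add_mset (g + h) Q). l \<le> m + 1"
proof -
  obtain F where F: "set_mset F \<subseteq> zero_sum_atoms" "size F = l"
    "sum_mset F = add_mset g (add_mset h Q)"
    using assms by (rule lengthsE)
  have "g \<in># sum_mset F" using F(3) by simp
  then obtain V where V: "V \<in># F" "g \<in># V" by (auto simp: in_Union_mset_iff)
  then obtain V1 E where V1: "V = add_mset g V1" and E: "F = add_mset V E" by (meson mset_add)
  have Q: "V1 + sum_mset E = add_mset h Q" using F(3) V1 E by simp
  show ?thesis
  proof (cases "h \<in># V1")
    case True
    then obtain R where "V1 = add_mset h R" by (meson mset_add)
    then have "size F \<in> lengths (add_mset (g + h) Q)"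
      using lengths_merge_same[OF F(1) _ F(3)] V V1 by blast
    then show ?thesis using F(2) by (intro bexI) auto
  next
    case False
    then have "h \<in># sum_mset E" using Q by (metis union_iff union_single_eq_member)
    then obtain W where W: "W \<in># E" "h \<in># W" by (auto simp: in_Union_mset_iff)
    then obtain W1 D where W1: "W = add_mset h W1" and D: "E = add_mset W D" by (meson mset_add)
    have Q': "Q = V1 + W1 + sum_mset D" using Q W1 D by (simp add: add.assoc)
    have "sum_mset V = 0" "sum_mset W = 0"
      using F(1) E D by (auto dest: zero_sum_atomsD(1))
    then have "sum_mset (add_mset (g + h) (V1 + W1)) = 0"
      using V1 W1 by (simp add: ac_simps)
    then obtain s where s: "s \<in> lengths (add_mset (g + h) (V1 + W1))"
      using lengths_nonempty by blast
    then have "s \<noteq> 0" using lengths_zero_iff by (metis add_mset_not_empty)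
    moreover have "s + size D \<in> lengths (add_mset (g + h) (V1 + W1) + sum_mset D)"
      using s F(1) E D by (intro lengths_add lengthsI) auto
    moreover have "l = size D + 2" using F(2) E D by simp
    ultimately show ?thesis using Q' by (intro bexI[of _ "s + size D"]) auto
  qed
qed

text \<open>Only the atom \<open>V\<close> containing \<open>g + h\<close> is affected. Splitting
  that term gives a sequence all of whose lengths are 1 or 2, because by
  \<open>lengths_merge\<close> a length exceeds the only length 1 of \<open>V\<close> by at most
  one.\<close>

lemma lengths_unmerge:
  assumes "m \<in> lengths (add_mset (g + h) Q)"
  shows "m \<in> lengths (add_mset g (add_mset h Q)) \<or> m + 1 \<in> lengths (add_mset g (add_mset h Q))"
proof -
  obtain F where F: "set_mset F \<subseteq> zero_sum_atoms" "size F = m"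
    "sum_mset F = add_mset (g + h) Q"
    using assms by (rule lengthsE)
  have "g + h \<in># sum_mset F" using F(3) by simp
  then obtain V where V: "V \<in># F" "g + h \<in># V" by (auto simp: in_Union_mset_iff)
  then obtain R E where R: "V = add_mset (g + h) R" and E: "F = add_mset V E" by (meson mset_add)
  have at: "V \<in> zero_sum_atoms" using F V by auto
  let ?X = "add_mset g (add_mset h R)"
  have "sum_mset ?X = 0" using zero_sum_atomsD(1)[OF at] R by (simp add: add.assoc)
  then obtain n where n: "n \<in> lengths ?X" using lengths_nonempty by blast
  have "n \<noteq> 0" using n lengths_zero_iff by (metis add_mset_not_empty)
  moreover have "n \<le> 2" using lengths_merge[OF n] lengths_atom[OF at] R by auto
  moreover have "n + size E \<in> lengths (?X + sum_mset E)"
    using n F(1) E by (intro lengths_add lengthsI) auto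
  moreover have "?X + sum_mset E = add_mset g (add_mset h Q)" using F(3) E R by simp
  moreover have "m = size E + 1" using F(2) E by simp
  ultimately show ?thesis
    by (metis Suc_1 Suc_eq_plus1 add.commute add_Suc_shift le_Suc_eq le_zero_eq One_nat_def)
qed

text \<open>The atom inside which two terms are merged belongs to a factorization of length \<open>k\<close>;
  that is why \<open>k\<close> itself survives.\<close>

lemma lengths_descent:
  fixes A :: "'a::ab_group_add multiset"
  assumes k: "k \<in> lengths A" and l: "l \<in> lengths A" and "k < l"
  shows "\<exists>B :: 'a multiset. size B < size A \<and> k \<in> lengths B \<and> (\<exists>m\<in>lengths B. l \<le> m + 1) \<and>
    (\<forall>m\<in>lengths B. m \<in> lengths A \<or> m + 1 \<in> lengths A)"
proof -
  obtain F where F: "set_mset F \<subseteq> zero_sum_atoms" "size F = k" "sum_mset F = A"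
    using k by (rule lengthsE)
  obtain E where E: "set_mset E \<subseteq> zero_sum_atoms" "size E = l" "sum_mset E = A"
    using l by (rule lengthsE)
  have size_le: "size M \<le> size (sum_mset M)" if "\<And>U. U \<in># M \<Longrightarrow> U \<noteq> {#}"
    for M :: "'a multiset multiset"
    using that by (induction M) (force simp: Suc_le_eq nonempty_has_size)+
  \<comment> \<open>If all atoms in \<open>F\<close> had length one, then \<open>size A\<close>
    would be \<open>k\<close>; but the \<open>l\<close> nonempty atoms in \<open>E\<close> force
    \<open>size A\<close> to be at least \<open>l\<close>.\<close>
  have "\<exists>U\<in>#F. size U \<noteq> 1"
  proof (rule ccontr)
    assume "\<not> ?thesis"
    then have "\<forall>U\<in>#F. size U = 1" by blast
    then have "size (sum_mset F) = size F" by (induction F) auto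
    moreover have "size E \<le> size (sum_mset E)"
      using E(1) zero_sum_atomsD(2) by (intro size_le) blast
    ultimately show False using F E \<open>k < l\<close> by simp
  qed
  then obtain U where U: "U \<in># F" "size U \<noteq> 1" by blast
  moreover have "U \<noteq> {#}" using U F zero_sum_atomsD(2) by blast
  ultimately have "size U = Suc (Suc (size U - 2))"
    by (metis One_nat_def Suc_1 Suc_diff_Suc diff_zero nat_neq_iff nonempty_has_size
        less_Suc0 Suc_lessI)
  then obtain g h R where R: "U = add_mset g (add_mset h R)"
    by (metis size_eq_Suc_imp_eq_union size_eq_Suc_imp_elem mset_add size_add_mset nat.inject)
  obtain F1 where "F = add_mset U F1" using U by (meson mset_add)
  then have A: "A = add_mset g (add_mset h (R + sum_mset F1))" using F(3) R by simp
  let ?B = "add_mset (g + h) (R + sum_mset F1)"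
  have "size ?B < size A" using A by simp
  moreover have "k \<in> lengths ?B" using lengths_merge_same[of F g h R] F U R A by auto
  moreover have "\<exists>m\<in>lengths ?B. l \<le> m + 1" using lengths_merge l A by blast
  moreover have "\<forall>m\<in>lengths ?B. m \<in> lengths A \<or> m + 1 \<in> lengths A"
    using lengths_unmerge A by blast
  ultimately show ?thesis by blast
qed

lemma lengths_intermediate:
  fixes A :: "'a::ab_group_add multiset"
  assumes "k \<in> lengths A" "l \<in> lengths A" "k \<le> j" "j \<le> l"
  shows "\<exists>B :: 'a multiset. k \<in> lengths B \<and> j \<in> lengths B"
  using assms
proof (induction "size A" arbitrary: A l rule: less_induct)
  case less
  show ?case
  proof (cases "j = k \<or> j = l")
    case True
    then show ?thesis using less.prems by blast
  next
    case False
    then have "k < l" using less.prems by simp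
    obtain B :: "'a multiset" where B: "size B < size A" "k \<in> lengths B" "\<exists>m\<in>lengths B. l \<le> m + 1"
      using lengths_descent[OF less.prems(1,2) \<open>k < l\<close>] by blast
    \<comment> \<open>Since \<open>j < l\<close>, the length \<open>m\<close> is still at least
      \<open>j\<close>. It may be larger than \<open>l\<close>, which is why the induction runs on
      the size of the sequence.\<close>
    then obtain m where "m \<in> lengths B" "l \<le> m + 1" by blast
    then show ?thesis using less.hyps[of B m] B less.prems False by simp
  qed
qed

section \<open>Gaps in sets of lengths\<close>

text \<open>Restates a distance inside the naturals, as the gap from a length \<open>k\<close> to
  its immediate successor; this is the form that the descent works on.\<close>

lemma group_distances_iff:
  fixes G :: "'a::ab_group_add itself"
  shows "d \<in> group_distances G \<longleftrightarrow> d \<ge> 1 \<and>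
    (\<exists>(A :: 'a multiset) k. k \<in> lengths A \<and> k + d \<in> lengths A \<and>
      (\<forall>m\<in>lengths A. k < m \<longrightarrow> k + d \<le> m))" (is "_ \<longleftrightarrow> ?R")
proof
  assume "d \<in> group_distances G"
  then obtain A :: "'a multiset" and k l where A: "d \<ge> 1" "k \<in> lengths A" "l \<in> lengths A"
    "int l - int k = int d" "\<forall>m\<in>lengths A. \<not> (k < m \<and> m < l)"
    by (auto simp: group_distances_def length_system_def distances_def)
  moreover from A have "l = k + d" by simp
  ultimately show ?R by (metis not_less)
next
  assume ?R
  then obtain A :: "'a multiset" and k where A: "d \<ge> 1" "k \<in> lengths A" "k + d \<in> lengths A"
      "\<forall>m\<in>lengths A. k < m \<longrightarrow> k + d \<le> m"
    by blast
  have "A \<in> zero_sum_seqs" using lengths_imp_zero_sum A by (auto simp: zero_sum_seqs_def)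
  moreover have "int (k + d) - int k = int d \<and> \<not> (\<exists>m\<in>int ` lengths A. int k < m \<and> m < int (k + d))"
    using A(4) by (force simp: not_less)
  then have "d \<in> distances (int ` lengths A)"
    unfolding distances_def using A(1-3) by blast
  ultimately show "d \<in> group_distances G"
    by (auto simp: group_distances_def length_system_def)
qed

lemma group_distances_pred:
  fixes G :: "'a::ab_group_add itself"
  assumes "d + 1 \<in> group_distances G" "d \<ge> 1"
  shows "d \<in> group_distances G"
proof -
  \<comment> \<open>Invariant of the descent: \<open>l\<close> is the successor of \<open>k\<close>
    among the lengths of \<open>A\<close>, and the gap is larger than \<open>d\<close>.\<close>
  have "d \<in> group_distances G"
    if "k \<in> lengths A" "l \<in> lengths A" "k + d < l" "\<forall>m\<in>lengths A. k < m \<longrightarrow> l \<le> m"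
    for A :: "'a multiset" and k l
    using that
  proof (induction "size A" arbitrary: A l rule: less_induct)
    case less
    obtain B :: "'a multiset" where B: "size B < size A" "k \<in> lengths B" "\<exists>m\<in>lengths B. l \<le> m + 1"
      "\<forall>m\<in>lengths B. m \<in> lengths A \<or> m + 1 \<in> lengths A"
      using lengths_descent[OF less.prems(1,2) add_lessD1[OF less.prems(3)]] by blast
    define n where "n = (LEAST m. m \<in> lengths B \<and> k < m)"
    \<comment> \<open>Some length of \<open>B\<close> is at least \<open>l - 1\<close>, hence at
      least \<open>k + d\<close>; positivity of \<open>d\<close> puts it strictly above
      \<open>k\<close>.\<close>
    have ex: "\<exists>m. m \<in> lengths B \<and> k < m" using B(3) less.prems(3) \<open>d \<ge> 1\<close> by force
    have n: "n \<in> lengths B" "k < n" using LeastI_ex[OF ex] by (simp_all add: n_def)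
    have least: "\<forall>m\<in>lengths B. k < m \<longrightarrow> n \<le> m" by (auto simp: n_def intro: Least_le)
    \<comment> \<open>One of \<open>n\<close> and \<open>n + 1\<close> is a length of
      \<open>A\<close> above \<open>k\<close>, so the gap shrinks by at most one and cannot jump
      over \<open>d\<close>.\<close>
    have "l \<le> n + 1" using B(4) n(1) less.prems(4) n(2) by force
    show ?case
    proof (cases "k + d < n")
      case True
      then show ?thesis using less.hyps[of B n] B n least by blast
    next
      case False
      then have "n = k + d" using \<open>l \<le> n + 1\<close> less.prems(3) by simp
      then show ?thesis using group_distances_iff n B(2) least \<open>d \<ge> 1\<close> by blast
    qed
  qed
  moreover obtain A :: "'a multiset" and k where "k \<in> lengths A" "k + (d + 1) \<in> lengths A"
    "\<forall>m\<in>lengths A. k < m \<longrightarrow> k + (d + 1) \<le> m"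
    using assms by (auto simp: group_distances_iff)
  ultimately show ?thesis by (metis less_add_one add.assoc)
qed

section \<open>The Davenport constant and some explicit atoms\<close>

text \<open>Pigeonhole on the first \<open>CARD('a) + 1\<close> partial sums, the empty one
  included: two of them agree, and the block between them is a nonempty zero-sum divisor with at
  most \<open>CARD('a)\<close> terms. A longer atom would contain it properly.\<close>

lemma size_atom_le_card:
  fixes U :: "'a::{ab_group_add, finite} multiset"
  assumes U: "U \<in> zero_sum_atoms"
  shows "size U \<le> CARD('a)"
proof (rule ccontr)
  assume less: "\<not> ?thesis"
  obtain xs where xs: "mset xs = U" using ex_mset by blast
  let ?s = "\<lambda>i. sum_list (take i xs)"
  have "card (?s ` {..CARD('a)}) \<le> CARD('a)" by (intro card_mono) auto
  then have "\<not> inj_on ?s {..CARD('a)}" by (intro pigeonhole) simp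
  then obtain i j where ij: "i < j" "j \<le> CARD('a)" "?s i = ?s j"
    unfolding inj_on_def by (metis atMost_iff nat_neq_iff)
  define ys where "ys = take (j - i) (drop i xs)"
  have "take j xs = take i xs @ ys"
    using ij by (metis add_diff_inverse_nat not_less_iff_gr_or_eq take_add ys_def)
  then have "sum_list ys = 0" using ij(3) by simp
  moreover have "xs = take i xs @ ys @ drop j xs"
    using \<open>take j xs = take i xs @ ys\<close> by (metis append.assoc append_take_drop_id)
  then have "mset ys \<subseteq># U"
    unfolding xs[symmetric] by (metis mset_append mset_subset_eq_add_left mset_subset_eq_add_right
        subset_mset.order_trans)
  ultimately have "mset ys = {#} \<or> mset ys = U"
    using zero_sum_atomsD(3)[OF U, of "mset ys"] by (simp add: sum_mset_sum_list)
  then have "length ys = 0 \<or> length ys = length xs" using xs by (metis size_mset size_empty)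
  moreover have "length xs > CARD('a)" using less xs by auto
  ultimately show False using ij by (simp add: ys_def)
qed

lemma finite_sizes_atoms: "finite (size ` (zero_sum_atoms :: 'a::{ab_group_add, finite} multiset set))"
  by (rule finite_subset[of _ "{..CARD('a)}"]) (auto intro: size_atom_le_card)

lemma size_atom_le_davenport:
  fixes U :: "'a::{ab_group_add, finite} multiset"
  assumes "U \<in> zero_sum_atoms"
  shows "size U \<le> davenport TYPE('a)"
  unfolding davenport_def using assms finite_sizes_atoms by (intro Max_ge) auto

lemma zero_atom: "{#0#} \<in> zero_sum_atoms"
  by (auto simp: zero_sum_atoms_iff mset_subset_eq_exists_conv single_is_union)

lemma davenport_attained:
  obtains U :: "'a::{ab_group_add, finite} multiset"
  where "U \<in> zero_sum_atoms" "size U = davenport TYPE('a)"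
proof -
  have "Max (size ` (zero_sum_atoms :: 'a multiset set)) \<in> size ` (zero_sum_atoms :: 'a multiset set)"
    using finite_sizes_atoms zero_atom by (intro Max_in) auto
  then show ?thesis using that by (force simp: davenport_def)
qed

lemma zero_in_atom:
  assumes "U \<in> zero_sum_atoms" "0 \<in># U"
  shows "U = {#0#}"
  using zero_sum_atomsD(3)[OF assms(1), of "{#0#}"] assms(2) by auto

lemma pair_atom:
  assumes "g \<noteq> 0"
  shows "{#g, -g#} \<in> zero_sum_atoms"
proof -
  have "T = {#} \<or> T = {#g, -g#}" if "T \<subseteq># {#g, -g#}" "sum_mset T = 0" for T
  proof (rule ccontr)
    assume c: "\<not> ?thesis"
    then have "size T < 2"
      using that(1) by (metis One_nat_def Suc_1 mset_subset_size size_add_mset size_empty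
          subset_mset.le_less)
    then have "size T = Suc 0" using c by (simp add: less_2_cases_iff)
    then obtain x where "T = {#x#}" by (metis size_1_singleton_mset One_nat_def)
    then show False using that assms by auto
  qed
  then show ?thesis by (simp add: zero_sum_atoms_iff)
qed

lemma uminus_atom:
  fixes U :: "'a::ab_group_add multiset"
  assumes U: "U \<in> zero_sum_atoms"
  shows "image_mset uminus U \<in> zero_sum_atoms"
proof -
  have sum_neg: "sum_mset (image_mset uminus T) = - sum_mset T" for T :: "'a multiset"
    by (induction T) auto
  have "T = {#} \<or> T = image_mset uminus U"
    if "T \<subseteq># image_mset uminus U" "sum_mset T = 0" for T
  proof -
    have "image_mset uminus T \<subseteq># U"
      using image_mset_subseteq_mono[OF that(1), of uminus] by (simp add: multiset.map_comp comp_def)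
    then have "image_mset uminus T = {#} \<or> image_mset uminus T = U"
      using zero_sum_atomsD(3)[OF U] that(2) sum_neg by (metis neg_equal_0_iff_equal)
    then show ?thesis by (auto simp: multiset.map_comp comp_def)
  qed
  then show ?thesis using zero_sum_atomsD(1,2)[OF U] by (simp add: zero_sum_atoms_iff sum_neg)
qed

text \<open>The product of \<open>U\<close> and its negative can be regrouped into the pairs
  \<open>{#g, -g#}\<close>, which are atoms since every \<open>g\<close> in \<open>U\<close> is
  nonzero. This is the source of all extremal examples below.\<close>

lemma lengths_atom_plus_uminus:
  assumes U: "U \<in> zero_sum_atoms" and "0 \<notin># U"
  shows "2 \<in> lengths (U + image_mset uminus U)" "size U \<in> lengths (U + image_mset uminus U)"
proof -
  show "2 \<in> lengths (U + image_mset uminus U)"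
    using lengths_add[of 1 U 1] U uminus_atom[OF U] one_in_lengths_iff by (metis one_add_one)
  have "sum_mset (image_mset (\<lambda>g. {#g, -g#}) U) = U + image_mset uminus U"
    by (induction U) auto
  moreover have "set_mset (image_mset (\<lambda>g. {#g, -g#}) U) \<subseteq> zero_sum_atoms"
  proof -
    have "{#g, -g#} \<in> zero_sum_atoms" if "g \<in># U" for g
      using that assms(2) by (intro pair_atom) auto
    then show ?thesis by auto
  qed
  ultimately show "size U \<in> lengths (U + image_mset uminus U)"
    using lengthsI by (metis size_image_mset)
qed

text \<open>There is room for nonzero \<open>g\<close> and \<open>h\<close>, possibly equal, with
  \<open>g + h\<close> nonzero; the third term is then nonzero as well. A nontrivial splitting of
  three terms has a part with a single term, which cannot sum to zero.\<close>

lemma triple_atom: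
  assumes "CARD('a) \<ge> 3"
  obtains U :: "'a::{ab_group_add, finite} multiset" where "U \<in> zero_sum_atoms" "size U = 3" "0 \<notin># U"
proof -
  have "\<not> UNIV \<subseteq> {0::'a}"
    using assms card_mono[of "{0::'a}" UNIV] by auto
  then obtain g :: 'a where g: "g \<noteq> 0" by blast
  have "\<not> UNIV \<subseteq> {0, -g}"
  proof
    assume "UNIV \<subseteq> {0, -g}"
    then have "CARD('a) \<le> card {0, -g}" by (intro card_mono) auto
    also have "\<dots> \<le> 2" by (simp add: card_insert_if)
    finally show False using assms by simp
  qed
  then obtain h where h: "h \<noteq> 0" "h \<noteq> -g" by blast
  let ?U = "{#g, h, -(g + h)#}"
  have gh: "g + h \<noteq> 0" using h by (metis add.inverse_unique add.commute)
  have nz: "0 \<notin># ?U" using g h gh by auto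
  have sum0: "sum_mset ?U = 0" by (simp add: algebra_simps)
  have single: "size T \<noteq> 1" if "T \<subseteq># ?U" "sum_mset T = 0" for T
  proof
    assume "size T = 1"
    then obtain x where "T = {#x#}" by (metis size_1_singleton_mset)
    then have "x \<in># ?U" "x = 0" using that by (auto dest: mset_subset_eqD)
    then show False using nz by simp
  qed
  have "T = {#} \<or> T = ?U" if T: "T \<subseteq># ?U" "sum_mset T = 0" for T
  proof -
    obtain C where C: "?U = T + C" using T(1) by (auto simp: mset_subset_eq_exists_conv)
    have "sum_mset C = 0" using sum0 T(2) unfolding C by simp
    then have "size T \<noteq> 1" "size C \<noteq> 1"
      using single T C by (metis mset_subset_eq_add_right)+
    moreover have "size T + size C = 3"
      using arg_cong[OF C, of size] by simp
    ultimately have "size T = 0 \<or> size C = 0" by arith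
    then show ?thesis using C by auto
  qed
  then have "?U \<in> zero_sum_atoms" using sum0 by (simp add: zero_sum_atoms_iff)
  with nz show ?thesis using that[of ?U] by simp
qed

section \<open>Bounds on gaps and on ratios of lengths\<close>

text \<open>Each term of \<open>U\<close> calls for at most one further factor from
  \<open>F\<close>.\<close>

lemma subseteq_sum_mset_small:
  assumes "U \<subseteq># sum_mset F"
  shows "\<exists>E. E \<subseteq># F \<and> size E \<le> size U \<and> U \<subseteq># sum_mset E"
  using assms
proof (induction U)
  case (add x U)
  then obtain E where E: "E \<subseteq># F" "size E \<le> size U" "U \<subseteq># sum_mset E"
    by (meson subset_mset.order_trans mset_subset_eq_insertD subset_mset.less_imp_le)
  then obtain D C where D: "F = E + D" and C: "sum_mset E = U + C"
    by (auto simp: mset_subset_eq_exists_conv)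
  \<comment> \<open>Cancelling \<open>U\<close> shows that \<open>x\<close> is either left over in
    the factors already chosen (\<open>C\<close>) or found in a factor not yet chosen
    (\<open>D\<close>).\<close>
  have "U + {#x#} \<subseteq># U + (C + sum_mset D)" using add.prems D C by (simp add: add.assoc)
  then have "x \<in># C + sum_mset D"
    unfolding subset_mset.add_le_cancel_left single_subset_iff .
  then consider "x \<in># C" | V where "V \<in># D" "x \<in># V" by (auto simp: in_Union_mset_iff)
  then show ?case
  proof cases
    case 1
    then have "add_mset x U \<subseteq># sum_mset E"
      using C by (metis mset_add mset_subset_eq_add_left union_mset_add_mset_left
          union_mset_add_mset_right)
    then show ?thesis using E by (intro exI[of _ E]) auto
  next
    case 2
    then obtain V1 D1 where "V = add_mset x V1" "D = add_mset V D1" by (meson mset_add)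
    then show ?thesis using D C E
      by (intro exI[of _ "add_mset V E"]) auto
  qed
qed auto

lemma lengths_next_le:
  fixes A :: "'a::{ab_group_add, finite} multiset"
  assumes "davenport TYPE('a) \<ge> 2" "k \<in> lengths A" "l \<in> lengths A" "k < l"
  shows "\<exists>m\<in>lengths A. k < m \<and> m \<le> k + (davenport TYPE('a) - 2)"
  using assms(2-)
proof (induction k arbitrary: A l)
  case 0
  then show ?case by (auto simp: lengths_zero_iff lengths_def)
next
  case (Suc k)
  define D where "D = davenport TYPE('a)"
  show ?case
  proof (cases "l \<le> Suc k + (D - 2)")
    case True
    then show ?thesis using Suc.prems D_def by blast
  next
    case False
    obtain F where F: "set_mset F \<subseteq> zero_sum_atoms" "size F = Suc k" "sum_mset F = A"
      using Suc.prems(1) by (rule lengthsE)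
    obtain U F1 where UF: "F = add_mset U F1" using F(2) by (metis size_eq_Suc_imp_eq_union)
    define B where "B = sum_mset F1"
    have U: "U \<in> zero_sum_atoms" and A: "A = U + B" and kB: "k \<in> lengths B"
      using F UF lengthsI[of F1] by (auto simp: B_def)
    have up: "Suc m \<in> lengths A" if "m \<in> lengths B" for m
      using lengths_add[OF _ that, of 1 U] U one_in_lengths_iff[of U] A by simp
    obtain E where E: "set_mset E \<subseteq> zero_sum_atoms" "size E = l" "sum_mset E = A"
      using Suc.prems(2) by (rule lengthsE)
    obtain E1 where E1: "E1 \<subseteq># E" "size E1 \<le> size U" "U \<subseteq># sum_mset E1"
      using subseteq_sum_mset_small[of U E] E A by auto
    then obtain E2 C where E2: "E = E1 + E2" and C: "sum_mset E1 = U + C"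
      by (auto simp: mset_subset_eq_exists_conv)
    have E1len: "size E1 \<in> lengths (sum_mset E1)" using E E2 by (intro lengthsI) auto
    have "sum_mset C = 0"
      using lengths_imp_zero_sum[OF E1len] zero_sum_atomsD(1)[OF U] C by simp
    then obtain s where s: "s \<in> lengths C" using lengths_nonempty by blast
    have "s + size E2 \<in> lengths (C + sum_mset E2)"
      using s E E2 by (intro lengths_add lengthsI) auto
    moreover have "C + sum_mset E2 = B" using E E2 C A by (simp add: add.assoc)
    ultimately have t: "s + size E2 \<in> lengths B" by simp
    \<comment> \<open>If \<open>C\<close> is empty, \<open>E1\<close> factors the atom
      \<open>U\<close> and has size 1. Otherwise \<open>s\<close> is at least 1, while
      \<open>E1\<close> has at most \<open>size U\<close>, hence at most \<open>D\<close>,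
      factors.\<close>
    have "size E1 \<le> s + (D - 1)"
    proof (cases "C = {#}")
      case True
      then have "size E1 = 1" using E1len C lengths_atom[OF U] by auto
      then show ?thesis using assms(1) by (simp add: D_def)
    next
      case False
      then have "s \<noteq> 0" using s lengths_zero_iff by metis
      then show ?thesis using E1(2) size_atom_le_davenport[OF U] by (simp add: D_def)
    qed
    \<comment> \<open>Here \<open>l\<close> exceeds \<open>k + (D - 1)\<close>, and passing from
      \<open>E\<close> to the factorization of \<open>B\<close> loses at most \<open>D - 1\<close>
      factors. Restoring \<open>U\<close> would regain one of them.\<close>
    then have "k < s + size E2" using False E(2) E2 by simp
    then obtain m where "m \<in> lengths B" "k < m" "m \<le> k + (D - 2)"
      using Suc.IH[OF kB t] by (auto simp: D_def)
    then show ?thesis using up by (intro bexI[of _ "Suc m"]) (auto simp: D_def)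
  qed
qed

lemma lengths_le_davenport:
  fixes A :: "'a::{ab_group_add, finite} multiset"
  assumes D: "davenport TYPE('a) \<ge> 2" and "k \<in> lengths A" "l \<in> lengths A"
  shows "2 * l \<le> k * davenport TYPE('a)"
proof -
  text \<open>Counting each zero twice gives the atom \<open>0\<close> the weight 2, so that every atom has
    weight between 2 and the Davenport constant.\<close>
  define w :: "'a multiset \<Rightarrow> nat" where "w A = size A + count A 0" for A
  have bounds: "2 \<le> w U \<and> w U \<le> davenport TYPE('a)" if U: "U \<in> zero_sum_atoms" for U
  proof (cases "0 \<in># U")
    case True
    then show ?thesis using zero_in_atom[OF U] D by (simp add: w_def)
  next
    case False
    have "size U \<noteq> 0" using zero_sum_atomsD(2)[OF U] by simp
    moreover have "size U \<noteq> 1"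
      using zero_sum_atomsD(1)[OF U] False by (auto dest: size_1_singleton_mset simp del: One_nat_def)
    ultimately show ?thesis
      using False size_atom_le_davenport[OF U]
      unfolding w_def by (simp add: not_in_iff[THEN iffD1] del: size_eq_0_iff_empty)
  qed
  have bounds_sum: "2 * size F \<le> w (sum_mset F) \<and> w (sum_mset F) \<le> size F * davenport TYPE('a)"
    if "set_mset F \<subseteq> zero_sum_atoms" for F
    using that
  proof (induction F)
    case (add U F)
    then have "2 * size F \<le> w (sum_mset F)" "w (sum_mset F) \<le> size F * davenport TYPE('a)"
        "2 \<le> w U" "w U \<le> davenport TYPE('a)" using bounds by auto
    moreover have "w (sum_mset (add_mset U F)) = w U + w (sum_mset F)" by (simp add: w_def)
    ultimately show ?case by simp
  qed (simp add: w_def)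
  obtain E where "set_mset E \<subseteq> zero_sum_atoms" "size E = k" "sum_mset E = A"
    using assms(2) by (rule lengthsE)
  then have "w A \<le> k * davenport TYPE('a)" using bounds_sum[of E] by simp
  moreover obtain F where "set_mset F \<subseteq> zero_sum_atoms" "size F = l" "sum_mset F = A"
    using assms(3) by (rule lengthsE)
  then have "2 * l \<le> w A" using bounds_sum[of F] by simp
  ultimately show ?thesis by simp
qed

section \<open>Unions of sets of lengths\<close>

text \<open>Naming the common product \<open>A\<close> makes the relation between \<open>k\<close>
  and \<open>l\<close> visibly symmetric for positive values.\<close>

lemma unions_of_lengths_iff:
  fixes G :: "'a::ab_group_add itself"
  shows "l \<in> unions_of_lengths G k \<longleftrightarrow> l \<ge> 1 \<and> (\<exists>A :: 'a multiset. k \<in> lengths A \<and> l \<in> lengths A)"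
proof
  assume "l \<in> unions_of_lengths G k"
  then obtain U V :: "'a multiset multiset" where "l \<ge> 1"
    "set_mset U \<subseteq> zero_sum_atoms" "size U = k" "set_mset V \<subseteq> zero_sum_atoms" "size V = l"
    "sum_mset U = sum_mset V"
    by (auto simp: unions_of_lengths_def)
  then show "l \<ge> 1 \<and> (\<exists>A :: 'a multiset. k \<in> lengths A \<and> l \<in> lengths A)"
    using lengthsI[of U] lengthsI[of V] by auto
next
  assume "l \<ge> 1 \<and> (\<exists>A :: 'a multiset. k \<in> lengths A \<and> l \<in> lengths A)"
  then obtain A :: "'a multiset" where A: "l \<ge> 1" "k \<in> lengths A" "l \<in> lengths A" by blast
  obtain U where "set_mset U \<subseteq> zero_sum_atoms" "size U = k" "sum_mset U = A"
    using A(2) by (rule lengthsE)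
  moreover obtain V where "set_mset V \<subseteq> zero_sum_atoms" "size V = l" "sum_mset V = A"
    using A(3) by (rule lengthsE)
  ultimately show "l \<in> unions_of_lengths G k"
    using A(1) unfolding unions_of_lengths_def
    by (intro CollectI conjI, simp) (rule exI[of _ U], rule exI[of _ V], simp)
qed

lemma unions_of_lengths_add:
  fixes G :: "'a::ab_group_add itself"
  assumes "l \<in> unions_of_lengths G k" "n \<in> unions_of_lengths G m"
  shows "l + n \<in> unions_of_lengths G (k + m)"
proof -
  obtain A B :: "'a multiset" where "k \<in> lengths A" "l \<in> lengths A" "m \<in> lengths B" "n \<in> lengths B"
    using assms by (auto simp: unions_of_lengths_iff)
  then have "k + m \<in> lengths (A + B)" "l + n \<in> lengths (A + B)" by (simp_all add: lengths_add)
  then show ?thesis using assms(1) by (auto simp: unions_of_lengths_iff)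
qed

lemma self_in_unions_of_lengths:
  fixes G :: "'a::ab_group_add itself"
  assumes "k \<ge> 1"
  shows "k \<in> unions_of_lengths G k"
proof -
  have "set_mset (replicate_mset k {#0::'a#}) \<subseteq> zero_sum_atoms"
    using zero_atom by (auto dest: in_replicate_mset[THEN iffD1])
  from lengthsI[OF this] have "k \<in> lengths (sum_mset (replicate_mset k {#0::'a#}))" by simp
  with assms show ?thesis unfolding unions_of_lengths_iff by blast
qed

lemma unions_of_lengths_commute:
  "k \<ge> 1 \<Longrightarrow> l \<in> unions_of_lengths G k \<Longrightarrow> k \<in> unions_of_lengths G l"
  by (auto simp: unions_of_lengths_iff)

lemma unions_of_lengths_convex_above:
  fixes G :: "'a::ab_group_add itself"
  assumes "l \<in> unions_of_lengths G k" "k \<le> j" "j \<le> l" "j \<ge> 1"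
  shows "j \<in> unions_of_lengths G k"
proof -
  obtain A :: "'a multiset" where "k \<in> lengths A" "l \<in> lengths A"
    using assms by (auto simp: unions_of_lengths_iff)
  from lengths_intermediate[OF this assms(2,3)] show ?thesis
    using assms(4) by (simp add: unions_of_lengths_iff)
qed

text \<open>By symmetry it suffices to relate \<open>j\<close> to \<open>k\<close>. Adding
  \<open>j - l\<close> factors to both factorizations behind the pair \<open>l\<close>,
  \<open>k\<close> relates \<open>j\<close> to some \<open>n\<close> that is at least
  \<open>k\<close>; convexity above \<open>j\<close> then reaches \<open>k\<close>.\<close>

lemma unions_of_lengths_convex_below:
  assumes "l \<in> unions_of_lengths G k" "l \<le> j" "j \<le> k"
  shows "j \<in> unions_of_lengths G k"
proof -
  have "l \<ge> 1" using assms by (simp add: unions_of_lengths_iff)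
  have kl: "k \<in> unions_of_lengths G l" using unions_of_lengths_commute[OF _ assms(1)] assms \<open>l \<ge> 1\<close> by simp
  have "\<exists>n\<ge>k. n \<in> unions_of_lengths G j"
  proof (cases "j = l")
    case False
    then have "j - l \<in> unions_of_lengths G (j - l)"
      using assms by (intro self_in_unions_of_lengths) auto
    from unions_of_lengths_add[OF kl this] show ?thesis
      using assms by (intro exI[of _ "k + (j - l)"]) simp
  qed (use kl in auto)
  then obtain n where "k \<le> n" "n \<in> unions_of_lengths G j" by blast
  then have "k \<in> unions_of_lengths G j"
    using assms \<open>l \<ge> 1\<close> by (intro unions_of_lengths_convex_above[of n G j k]) auto
  from unions_of_lengths_commute[OF _ this] show ?thesis using assms \<open>l \<ge> 1\<close> by simp
qed

lemma int_interval_image_int: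
  assumes "finite X" "\<And>i j k. i \<in> X \<Longrightarrow> k \<in> X \<Longrightarrow> i \<le> j \<Longrightarrow> j \<le> k \<Longrightarrow> j \<in> X"
  shows "int_interval (int ` X)"
proof (cases "X = {}")
  case False
  then have "X = {Min X..Max X}"
    using assms(1) by (auto intro: assms(2)[OF Min_in Max_in])
  then have "int ` X = {int (Min X)..int (Max X)}" by (metis image_int_atLeastAtMost)
  then show ?thesis unfolding int_interval_def by blast
next
  case True
  then have "int ` X = {1..0}" by simp
  then show ?thesis unfolding int_interval_def by blast
qed

section \<open>Elasticities and distances for groups of order at least three\<close>

context
  fixes G :: "'a::{ab_group_add, finite} itself"
  assumes card: "CARD('a) \<ge> 3"
begin

lemma davenport_eq: "davenport TYPE('a) = davenport G"
  by (simp add: davenport_def)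

lemma davenport_ge_3: "davenport G \<ge> 3"
  using triple_atom[OF card] size_atom_le_davenport davenport_eq by metis

lemma unions_of_lengths_le:
  assumes "l \<in> unions_of_lengths G k"
  shows "2 * l \<le> k * davenport G"
proof -
  obtain A :: "'a multiset" where "k \<in> lengths A" "l \<in> lengths A"
    using assms by (auto simp: unions_of_lengths_iff)
  then show ?thesis using lengths_le_davenport[of k A l] davenport_ge_3 davenport_eq by simp
qed

text \<open>Take an atom \<open>U\<close> of maximal length times its negative. As \<open>U\<close>
  has at least three terms, it is not \<open>{#0#}\<close> and so does not contain 0.\<close>

lemma lengths_two_davenport:
  obtains A :: "'a multiset" where "2 \<in> lengths A" "davenport G \<in> lengths A"
proof -
  obtain U :: "'a multiset" where U: "U \<in> zero_sum_atoms" "size U = davenport G"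
    using davenport_attained davenport_eq by metis
  have "0 \<notin># U" using zero_in_atom[OF U(1)] U(2) davenport_ge_3 by auto
  then show ?thesis using lengths_atom_plus_uminus[OF U(1)] U(2) that by metis
qed

lemma unions_of_lengths_even:
  assumes "k \<ge> 1"
  shows "k * davenport G \<in> unions_of_lengths G (2 * k)"
proof -
  obtain A :: "'a multiset" where A: "2 \<in> lengths A" "davenport G \<in> lengths A"
    by (rule lengths_two_davenport)
  then have two: "davenport G \<in> unions_of_lengths G 2"
    using davenport_ge_3 by (auto simp: unions_of_lengths_iff)
  from assms show ?thesis
  proof (induction k rule: nat_induct_at_least)
    case (Suc k)
    show ?case using unions_of_lengths_add[OF two Suc.IH] by simp
  qed (use two in simp)
qed

text \<open>A value between two members is compared with \<open>k\<close>: from \<open>k\<close>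
  upwards the larger member suffices, below \<open>k\<close> the smaller one.\<close>

lemma int_interval_unions_of_lengths:
  assumes "k \<ge> 1"
  shows "int_interval (int ` unions_of_lengths G k)"
proof (rule int_interval_image_int)
  show "finite (unions_of_lengths G k)"
    by (rule finite_subset[of _ "{..k * davenport G}"]) (auto dest: unions_of_lengths_le)
  fix i j l
  assume il: "i \<in> unions_of_lengths G k" "l \<in> unions_of_lengths G k" "i \<le> j" "j \<le> l"
  show "j \<in> unions_of_lengths G k"
  proof (cases "k \<le> j")
    case True
    then show ?thesis using unions_of_lengths_convex_above[OF il(2) _ il(4)] assms by simp
  next
    case False
    then show ?thesis using unions_of_lengths_convex_below[OF il(1,3)] by simp
  qed
qed

lemma kth_elasticity_even:
  assumes "k \<ge> 1"
  shows "kth_elasticity G (2 * k) = enat (k * davenport G)"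
  unfolding kth_elasticity_def
proof (rule antisym)
  show "(SUP l\<in>unions_of_lengths G (2 * k). enat l) \<le> enat (k * davenport G)"
    using unions_of_lengths_le by (intro SUP_least) fastforce
  show "enat (k * davenport G) \<le> (SUP l\<in>unions_of_lengths G (2 * k). enat l)"
    by (rule SUP_upper[OF unions_of_lengths_even[OF assms]])
qed

lemma kth_elasticity_odd:
  assumes "k \<ge> 1"
  shows "enat (1 + k * davenport G) \<le> kth_elasticity G (2 * k + 1)"
    "kth_elasticity G (2 * k + 1) \<le> enat (k * davenport G + davenport G div 2)"
proof -
  \<comment> \<open>One common extra factor is multiplied onto the extremal example for
    \<open>2 * k\<close>.\<close>
  have "k * davenport G + 1 \<in> unions_of_lengths G (2 * k + 1)"
    using assms by (intro unions_of_lengths_add unions_of_lengths_even self_in_unions_of_lengths) auto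
  then show "enat (1 + k * davenport G) \<le> kth_elasticity G (2 * k + 1)"
    unfolding kth_elasticity_def by (metis SUP_upper add.commute)
  have "l \<le> k * davenport G + davenport G div 2" if "l \<in> unions_of_lengths G (2 * k + 1)" for l
    using unions_of_lengths_le[OF that] by (simp add: algebra_simps)
  then show "kth_elasticity G (2 * k + 1) \<le> enat (k * davenport G + davenport G div 2)"
    unfolding kth_elasticity_def by (intro SUP_least) simp
qed

lemma elasticity_eq: "elasticity G = ereal (real (davenport G) / 2)"
  unfolding elasticity_def
proof (rule antisym)
  have "set_elasticity (lengths A) \<le> ereal (real (davenport G) / 2)"
    if "sum_mset A = 0" for A :: "'a multiset"
  proof (cases "lengths A = {0}")
    case True
    then show ?thesis using davenport_ge_3 by (simp add: set_elasticity_def one_ereal_def)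
  next
    case False
    have "lengths A \<noteq> {}" using lengths_nonempty[OF that] by blast
    then have n: "Inf (lengths A) \<in> lengths A" by (rule Inf_nat_def1)
    have "A \<noteq> {#}" using False by (auto simp: lengths_def)
    \<comment> \<open>Positivity keeps the division in the extended reals away from a zero
      denominator.\<close>
    then have pos: "Inf (lengths A) > 0" using n lengths_zero_iff by (metis gr0I)
    have "real l \<le> real (Inf (lengths A)) * (real (davenport G) / 2)" if "l \<in> lengths A" for l
    proof -
      have "2 * l \<le> Inf (lengths A) * davenport G"
        using lengths_le_davenport[OF _ n that] davenport_ge_3 davenport_eq by simp
      then have "real (2 * l) \<le> real (Inf (lengths A) * davenport G)" by (rule of_nat_mono)
      then show ?thesis by simp
    qed
    then have "(SUP l\<in>lengths A. ereal (real l)) \<le>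
        ereal (real (Inf (lengths A)) * (real (davenport G) / 2))"
      by (intro SUP_least) simp
    then show ?thesis
      using False pos by (simp add: set_elasticity_def ereal_divide_le_pos)
  qed
  then show "(SUP L\<in>length_system G. set_elasticity L) \<le> ereal (real (davenport G) / 2)"
    by (intro SUP_least) (auto simp: length_system_def zero_sum_seqs_def)
  obtain A :: "'a multiset" where A: "2 \<in> lengths A" "davenport G \<in> lengths A"
    by (rule lengths_two_davenport)
  have n: "Inf (lengths A) \<in> lengths A" using A by (intro Inf_nat_def1) auto
  have "A \<noteq> {#}" using A by (auto simp: lengths_def)
  then have pos: "Inf (lengths A) > 0" using n lengths_zero_iff by (metis gr0I)
  \<comment> \<open>An upper bound on the minimum is enough, since a smaller denominator only
    increases the quotient.\<close>
  have "Inf (lengths A) \<le> 2" using A(1) by (rule wellorder_Inf_le1)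
  then have "real (davenport G) / 2 \<le> real (davenport G) / real (Inf (lengths A))"
    using pos by (intro divide_left_mono) auto
  then have "ereal (real (davenport G) / 2) \<le> ereal (real (davenport G)) / ereal (real (Inf (lengths A)))"
    using pos by simp
  moreover have "ereal (real (davenport G)) / ereal (real (Inf (lengths A))) \<le>
      (SUP l\<in>lengths A. ereal (real l)) / ereal (real (Inf (lengths A)))"
    using A(2) pos by (intro ereal_divide_right_mono SUP_upper2[of "davenport G"]) auto
  ultimately have "ereal (real (davenport G) / 2) \<le>
      (SUP l\<in>lengths A. ereal (real l)) / ereal (real (Inf (lengths A)))"
    by (rule order.trans)
  moreover have "lengths A \<noteq> {0}" using A(1) by (metis singletonD zero_neq_numeral)
  ultimately have "ereal (real (davenport G) / 2) \<le> set_elasticity (lengths A)"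
    by (simp only: set_elasticity_def if_False)
  moreover have "lengths A \<in> length_system G"
    using lengths_imp_zero_sum[OF A(1)] by (simp add: length_system_def zero_sum_seqs_def)
  ultimately show "ereal (real (davenport G) / 2) \<le> (SUP L\<in>length_system G. set_elasticity L)"
    by (rule SUP_upper2[rotated])
qed

text \<open>An atom of three nonzero terms times its negative has the consecutive lengths 2 and
  3.\<close>

lemma one_in_group_distances: "1 \<in> group_distances G"
proof -
  obtain U :: "'a multiset" where "U \<in> zero_sum_atoms" "size U = 3" "0 \<notin># U"
    using triple_atom[OF card] .
  then have "2 \<in> lengths (U + image_mset uminus U)" "2 + 1 \<in> lengths (U + image_mset uminus U)"
    using lengths_atom_plus_uminus[of U] by simp_all
  then show ?thesis unfolding group_distances_iff
    by (intro conjI exI[of _ "U + image_mset uminus U"] exI[of _ 2]) auto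
qed

lemma group_distances_le:
  assumes "d \<in> group_distances G"
  shows "d \<le> davenport G - 2"
proof -
  obtain A :: "'a multiset" and k where A: "d \<ge> 1" "k \<in> lengths A" "k + d \<in> lengths A"
      "\<forall>m\<in>lengths A. k < m \<longrightarrow> k + d \<le> m"
    using assms unfolding group_distances_iff by blast
  then obtain m where "m \<in> lengths A" "k < m" "m \<le> k + (davenport G - 2)"
    using lengths_next_le[of k A "k + d"] davenport_ge_3 davenport_eq by auto
  with A(4) show ?thesis by fastforce
qed

text \<open>Starting from any distance, in particular the maximum,
  \<open>group_distances_pred\<close> descends one by one to 1.\<close>

lemma group_distances_eq: "group_distances G = {1..Max (group_distances G)}"
proof -
  have fin: "finite (group_distances G)"
    by (rule finite_subset[of _ "{..davenport G - 2}"]) (auto dest: group_distances_le)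
  have ne: "group_distances G \<noteq> {}" using one_in_group_distances by auto
  have "j \<in> group_distances G" if "j \<le> d" "d \<in> group_distances G" "1 \<le> j" for j d
    using that
  proof (induction rule: inc_induct)
    case (step n)
    then show ?case using group_distances_pred[of n G] by simp
  qed
  then have "{1..Max (group_distances G)} \<subseteq> group_distances G" using Max_in[OF fin ne] by auto
  moreover have "group_distances G \<subseteq> {1..Max (group_distances G)}"
    using fin by (auto simp: group_distances_iff)
  ultimately show ?thesis by (rule antisym[rotated])
qed

end

theorem proposition6p1:
  fixes G :: "'a::{ab_group_add, finite} itself"
  assumes "CARD('a) \<ge> 3"
  shows
    "((\<forall>k\<ge>1. int_interval (int ` unions_of_lengths G k)) \<and>
      elasticity G = ereal (real (davenport G) / 2) \<and>
      (\<forall>k\<ge>1. kth_elasticity G (2 * k) = enat (k * davenport G)) \<and>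
      (\<forall>k\<ge>1. enat (1 + k * davenport G) \<le> kth_elasticity G (2 * k + 1) \<and>
             kth_elasticity G (2 * k + 1) \<le> enat (k * davenport G + davenport G div 2))) \<and>
     (int_interval (int ` group_distances G) \<and>
      group_distances G \<noteq> {} \<and>
      Min (group_distances G) = 1 \<and>
      int (Max (group_distances G)) \<le> int (davenport G) - 2)"
proof (intro conjI allI impI)
  note [simp] = assms
  let ?M = "Max (group_distances G)"
  have eq: "group_distances G = {1..?M}" by (rule group_distances_eq) simp
  show "group_distances G \<noteq> {}" using one_in_group_distances[OF assms, of G] by auto
  have "finite (group_distances G)" by (subst eq) simp
  then have "?M \<in> group_distances G" using \<open>group_distances G \<noteq> {}\<close> by (rule Max_in)
  then have "?M \<le> davenport G - 2" by (intro group_distances_le) simp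
  \<comment> \<open>The Davenport constant is at least 3, so the truncated difference of naturals
    agrees with the integer one.\<close>
  then show "int ?M \<le> int (davenport G) - 2" using davenport_ge_3[OF assms, of G] by simp
  have "int ` group_distances G = {1..int ?M}"
    using eq image_int_atLeastAtMost[of 1 ?M] by simp
  then show "int_interval (int ` group_distances G)" unfolding int_interval_def by blast
  show "Min (group_distances G) = 1"
    using \<open>finite (group_distances G)\<close> one_in_group_distances[OF assms, of G]
    by (intro Min_eqI) (auto simp: group_distances_iff)
qed (use assms in \<open>simp_all add: int_interval_unions_of_lengths elasticity_eq kth_elasticity_even
  kth_elasticity_odd del: One_nat_def\<close>)

end
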